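(* For every integer $n>1$, the girth of the undirected zero divisor graph $\overline{\Gamma}(\mathbb{Z}_n[i,j,k])$ is equal to $3$.
   Context: $\mathbb{Z}_n[i,j,k]=\{a+bi+cj+dk: a,b,c,d\in\mathbb{Z}_n\}$ is the ring of Lipschitz quaternions modulo $n$, with $i^2=j^2=k^2=ijk=-1$ and coefficients in $\mathbb{Z}_n$ (integers modulo $n$) central. For a ring $R$, an element $x$ is a zero divisor if there is a nonzero $y\in R$ with $xy=0$ or $yx=0$. The undirected zero divisor graph $\overline{\Gamma}(R)$ is the simple graph whose vertices are the nonzero zero divisors of $R$, with distinct $x,y$ adjacent iff $xy=0$ or $yx=0$. The girth of a graph is the length of a shortest cycle (infinity if there is no cycle). *)

theory Defs
  imports
    "HOL-Number_Theory.Residues"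
    "HOL-Library.Extended_Nat"
begin

section \<open>Lipschitz quaternions over a ring\<close>

text \<open>\<open>Quat a b c d\<close> stands for $a + bi + cj + dk$.\<close>

datatype 'a quat = Quat (qre: 'a) (qi: 'a) (qj: 'a) (qk: 'a)

text \<open>
  The product formula is the bilinear extension of $i^2 = j^2 = k^2 = ijk = -1$ with coefficients
  commuting with $i$, $j$, $k$; the lemmas below check this presentation.
\<close>

definition quat_mult :: "('a, 'b) ring_scheme \<Rightarrow> 'a quat \<Rightarrow> 'a quat \<Rightarrow> 'a quat" where
  "quat_mult R x y = Quat
    (qre x \<otimes>\<^bsub>R\<^esub> qre y \<ominus>\<^bsub>R\<^esub> qi x \<otimes>\<^bsub>R\<^esub> qi y \<ominus>\<^bsub>R\<^esub> qj x \<otimes>\<^bsub>R\<^esub> qj y \<ominus>\<^bsub>R\<^esub> qk x \<otimes>\<^bsub>R\<^esub> qk y)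
    (qre x \<otimes>\<^bsub>R\<^esub> qi y \<oplus>\<^bsub>R\<^esub> qi x \<otimes>\<^bsub>R\<^esub> qre y \<oplus>\<^bsub>R\<^esub> qj x \<otimes>\<^bsub>R\<^esub> qk y \<ominus>\<^bsub>R\<^esub> qk x \<otimes>\<^bsub>R\<^esub> qj y)
    (qre x \<otimes>\<^bsub>R\<^esub> qj y \<ominus>\<^bsub>R\<^esub> qi x \<otimes>\<^bsub>R\<^esub> qk y \<oplus>\<^bsub>R\<^esub> qj x \<otimes>\<^bsub>R\<^esub> qre y \<oplus>\<^bsub>R\<^esub> qk x \<otimes>\<^bsub>R\<^esub> qi y)
    (qre x \<otimes>\<^bsub>R\<^esub> qk y \<oplus>\<^bsub>R\<^esub> qi x \<otimes>\<^bsub>R\<^esub> qj y \<ominus>\<^bsub>R\<^esub> qj x \<otimes>\<^bsub>R\<^esub> qi y \<oplus>\<^bsub>R\<^esub> qk x \<otimes>\<^bsub>R\<^esub> qre y)"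

definition quat_ring :: "('a, 'b) ring_scheme \<Rightarrow> 'a quat ring" where
  "quat_ring R =
    \<lparr>carrier = {x. qre x \<in> carrier R \<and> qi x \<in> carrier R \<and> qj x \<in> carrier R \<and> qk x \<in> carrier R},
     monoid.mult = quat_mult R,
     one = Quat \<one>\<^bsub>R\<^esub> \<zero>\<^bsub>R\<^esub> \<zero>\<^bsub>R\<^esub> \<zero>\<^bsub>R\<^esub>,
     zero = Quat \<zero>\<^bsub>R\<^esub> \<zero>\<^bsub>R\<^esub> \<zero>\<^bsub>R\<^esub> \<zero>\<^bsub>R\<^esub>,
     add = \<lambda>x y. Quat (qre x \<oplus>\<^bsub>R\<^esub> qre y) (qi x \<oplus>\<^bsub>R\<^esub> qi y) (qj x \<oplus>\<^bsub>R\<^esub> qj y) (qk x \<oplus>\<^bsub>R\<^esub> qk y)\<rparr>"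

lemma (in cring) quat_ring: "ring (quat_ring R)"
proof (rule ringI)
  show "abelian_group (quat_ring R)"
  proof (rule abelian_groupI)
    fix x assume "x \<in> carrier (quat_ring R)"
    then show "\<exists>y\<in>carrier (quat_ring R). y \<oplus>\<^bsub>quat_ring R\<^esub> x = \<zero>\<^bsub>quat_ring R\<^esub>"
      by (intro bexI[of _ "Quat (\<ominus> qre x) (\<ominus> qi x) (\<ominus> qj x) (\<ominus> qk x)"])
        (auto simp: quat_ring_def l_neg)
  qed (auto simp: quat_ring_def a_ac)
next
  show "monoid (quat_ring R)"
  proof (rule monoidI)
    fix x y z assume "x \<in> carrier (quat_ring R)" "y \<in> carrier (quat_ring R)"
      "z \<in> carrier (quat_ring R)"
    then show "x \<otimes>\<^bsub>quat_ring R\<^esub> y \<otimes>\<^bsub>quat_ring R\<^esub> z = x \<otimes>\<^bsub>quat_ring R\<^esub> (y \<otimes>\<^bsub>quat_ring R\<^esub> z)"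
      by (cases x; cases y; cases z)
        (simp add: quat_ring_def quat_mult_def a_minus_def l_distr r_distr l_minus r_minus
          minus_add a_ac m_ac)
  qed (auto simp: quat_ring_def quat_mult_def a_minus_def intro!: quat.expand)
qed (auto simp: quat_ring_def quat_mult_def a_minus_def l_distr r_distr minus_add a_ac)

lemma (in cring) quat_ring_relations:
  defines "H \<equiv> quat_ring R"
  defines "i \<equiv> Quat \<zero> \<one> \<zero> \<zero>" and "j \<equiv> Quat \<zero> \<zero> \<one> \<zero>" and "k \<equiv> Quat \<zero> \<zero> \<zero> \<one>"
  shows "i \<otimes>\<^bsub>H\<^esub> i = \<ominus>\<^bsub>H\<^esub> \<one>\<^bsub>H\<^esub>" "j \<otimes>\<^bsub>H\<^esub> j = \<ominus>\<^bsub>H\<^esub> \<one>\<^bsub>H\<^esub>" "k \<otimes>\<^bsub>H\<^esub> k = \<ominus>\<^bsub>H\<^esub> \<one>\<^bsub>H\<^esub>"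
    "i \<otimes>\<^bsub>H\<^esub> j \<otimes>\<^bsub>H\<^esub> k = \<ominus>\<^bsub>H\<^esub> \<one>\<^bsub>H\<^esub>"
proof -
  interpret H: ring H unfolding H_def by (rule quat_ring)
  have m1: "\<ominus>\<^bsub>H\<^esub> \<one>\<^bsub>H\<^esub> = Quat (\<ominus> \<one>) \<zero> \<zero> \<zero>"
    by (rule H.minus_equality) (auto simp: H_def quat_ring_def l_neg)
  show "i \<otimes>\<^bsub>H\<^esub> i = \<ominus>\<^bsub>H\<^esub> \<one>\<^bsub>H\<^esub>" "j \<otimes>\<^bsub>H\<^esub> j = \<ominus>\<^bsub>H\<^esub> \<one>\<^bsub>H\<^esub>" "k \<otimes>\<^bsub>H\<^esub> k = \<ominus>\<^bsub>H\<^esub> \<one>\<^bsub>H\<^esub>"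
    "i \<otimes>\<^bsub>H\<^esub> j \<otimes>\<^bsub>H\<^esub> k = \<ominus>\<^bsub>H\<^esub> \<one>\<^bsub>H\<^esub>"
    unfolding m1 by (auto simp: H_def i_def j_def k_def quat_ring_def quat_mult_def a_minus_def)
qed

lemma (in cring) quat_ring_central:
  assumes "a \<in> carrier R" "x \<in> carrier (quat_ring R)"
  shows "Quat a \<zero> \<zero> \<zero> \<otimes>\<^bsub>quat_ring R\<^esub> x = x \<otimes>\<^bsub>quat_ring R\<^esub> Quat a \<zero> \<zero> \<zero>"
  using assms by (auto simp: quat_ring_def quat_mult_def a_minus_def m_ac)

lemma (in cring) quat_ring_basis:
  assumes "a \<in> carrier R" "b \<in> carrier R" "c \<in> carrier R" "d \<in> carrier R"
  defines "H \<equiv> quat_ring R"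
  shows "Quat a b c d = Quat a \<zero> \<zero> \<zero>
    \<oplus>\<^bsub>H\<^esub> Quat b \<zero> \<zero> \<zero> \<otimes>\<^bsub>H\<^esub> Quat \<zero> \<one> \<zero> \<zero>
    \<oplus>\<^bsub>H\<^esub> Quat c \<zero> \<zero> \<zero> \<otimes>\<^bsub>H\<^esub> Quat \<zero> \<zero> \<one> \<zero>
    \<oplus>\<^bsub>H\<^esub> Quat d \<zero> \<zero> \<zero> \<otimes>\<^bsub>H\<^esub> Quat \<zero> \<zero> \<zero> \<one>"
  using assms(1-4) by (simp add: H_def quat_ring_def quat_mult_def a_minus_def)

section \<open>Simple graphs and girth\<close>

text \<open>A graph is a pair of a vertex set and a set of edges, each a two-element set of vertices.\<close>

type_synonym 'a ugraph = "'a set \<times> 'a set set"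

text \<open>
  A cycle is listed by its vertices without repeating the first one at the end, so the length
  of the cycle is the length of the list. The bound 3 excludes going back and forth along an edge.
\<close>

definition is_cycle :: "'a ugraph \<Rightarrow> 'a list \<Rightarrow> bool" where
  "is_cycle G p \<longleftrightarrow> 3 \<le> length p \<and> distinct p \<and> set p \<subseteq> fst G \<and>
    (\<forall>m < length p. {p ! m, p ! (Suc m mod length p)} \<in> snd G)"

text \<open>The infimum in \<^typ>\<open>enat\<close> over the empty set is \<open>\<infinity>\<close>.\<close>

definition girth :: "'a ugraph \<Rightarrow> enat" where
  "girth G = (INF p \<in> {p. is_cycle G p}. enat (length p))"

section \<open>Zero divisor graphs\<close>

definition zero_divisor :: "('a, 'b) ring_scheme \<Rightarrow> 'a \<Rightarrow> bool" where
  "zero_divisor R x \<longleftrightarrow> x \<in> carrier R \<and>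
    (\<exists>y \<in> carrier R. y \<noteq> \<zero>\<^bsub>R\<^esub> \<and> (x \<otimes>\<^bsub>R\<^esub> y = \<zero>\<^bsub>R\<^esub> \<or> y \<otimes>\<^bsub>R\<^esub> x = \<zero>\<^bsub>R\<^esub>))"

definition zero_divisor_graph :: "('a, 'b) ring_scheme \<Rightarrow> 'a ugraph" where
  "zero_divisor_graph R =
    (let V = {x. zero_divisor R x \<and> x \<noteq> \<zero>\<^bsub>R\<^esub>}
     in (V, {{x, y} | x y. x \<in> V \<and> y \<in> V \<and> x \<noteq> y \<and>
                (x \<otimes>\<^bsub>R\<^esub> y = \<zero>\<^bsub>R\<^esub> \<or> y \<otimes>\<^bsub>R\<^esub> x = \<zero>\<^bsub>R\<^esub>)}))"

end

theory Submission
  imports Defs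
begin

text \<open>
  Every cycle has length at least 3, so a triangle has to be exhibited. In any ring, an element
  \<open>q\<close> with \<open>q\<^sup>2 = 0\<close> yields one: \<open>q\<close>, a right multiple \<open>q r\<close> and a left multiple \<open>s q\<close>
  are pairwise adjacent as soon as they are distinct and nonzero, because each of the products \<open>q (q r)\<close>, \<open>(s q) q\<close> and
  \<open>(s q) (q r)\<close> contains the factor \<open>q\<^sup>2\<close>.

  Over \<open>\<int>\<^sub>n\<close> such a \<open>q\<close> comes from a prime divisor \<open>p\<close> of \<open>n\<close>. The congruence
  \<open>1 + a\<^sup>2 + b\<^sup>2 \<equiv> 0\<close> modulo \<open>p\<close> is solvable by the pigeonhole principle, so the pure
  quaternion \<open>i + a j + b k\<close> squares to a multiple of \<open>p\<close>, and scaling it by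
  \<open>c = n / p\<close> makes the square vanish modulo \<open>n\<close>, since \<open>n = c p\<close> divides \<open>c\<^sup>2 p\<close>. The choice \<open>r = i\<close>, \<open>s = 1 + i\<close>
  keeps the three vertices distinct and nonzero for every \<open>n\<close>, even or odd: their coordinates at \<open>1\<close> and \<open>i\<close>
  are \<open>(0, c)\<close>, \<open>(-c, 0)\<close> and \<open>(-c, c)\<close>.
\<close>

lemma girth_ge_3: "3 \<le> girth G"
  unfolding girth_def
proof (rule INF_greatest)
  fix p assume "p \<in> {p. is_cycle G p}"
  then have "enat 3 \<le> enat (length p)"
    by (simp add: is_cycle_def)
  then show "3 \<le> enat (length p)"
    by (simp only: numeral_eq_enat)
qed

lemma girth_eq_3_if_triangle:
  assumes "is_cycle G [x, y, z]"
  shows "girth G = 3"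
proof (rule antisym)
  have "girth G \<le> enat (length [x, y, z])"
    unfolding girth_def using assms by (intro INF_lower) simp
  then show "girth G \<le> 3"
    by (simp add: numeral_eq_enat eval_nat_numeral)
qed (rule girth_ge_3)

lemma (in ring) girth_eq_3_if_square_zero:
  assumes q: "q \<in> carrier R" and r: "r \<in> carrier R" and s: "s \<in> carrier R"
    and sq: "q \<otimes> q = \<zero>"
    and nonzero: "q \<noteq> \<zero>" "q \<otimes> r \<noteq> \<zero>" "s \<otimes> q \<noteq> \<zero>"
    and distinct: "distinct [q, q \<otimes> r, s \<otimes> q]"
  shows "girth (zero_divisor_graph R) = 3"
proof -
  have 1: "q \<otimes> (q \<otimes> r) = \<zero>"
    using q r sq by (simp flip: m_assoc)
  have 2: "(s \<otimes> q) \<otimes> q = \<zero>"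
    using q s sq by (simp add: m_assoc)
  have 3: "(s \<otimes> q) \<otimes> (q \<otimes> r) = \<zero>"
    using q r s 1 by (simp add: m_assoc)
  have zd: "zero_divisor R q" "zero_divisor R (q \<otimes> r)" "zero_divisor R (s \<otimes> q)"
    unfolding zero_divisor_def using q r s sq nonzero 1 2 by (auto intro: m_closed)
  have "is_cycle (zero_divisor_graph R) [q, q \<otimes> r, s \<otimes> q]"
    unfolding is_cycle_def zero_divisor_graph_def Let_def
    using zd nonzero distinct 1 2 3 by (auto simp: less_Suc_eq)
  then show ?thesis
    by (rule girth_eq_3_if_triangle)
qed

text \<open>
  Under the hypothesis on \<open>c\<close>, the pure quaternion \<open>c (i + a j + b k)\<close> squares to zero, since
  the square of a pure quaternion is minus its norm.
\<close>

lemma (in cring) girth_quat_ring_eq_3: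
  assumes a: "a \<in> carrier R" and b: "b \<in> carrier R" and c: "c \<in> carrier R" "c \<noteq> \<zero>"
    and norm: "c \<otimes> c \<otimes> (\<one> \<oplus> a \<otimes> a \<oplus> b \<otimes> b) = \<zero>"
  shows "girth (zero_divisor_graph (quat_ring R)) = 3"
proof -
  interpret H: ring "quat_ring R"
    by (rule quat_ring)
  define q where "q = Quat \<zero> c (c \<otimes> a) (c \<otimes> b)"
  define r where "r = Quat \<zero> \<one> \<zero> \<zero>"
  define s where "s = Quat \<one> \<one> \<zero> \<zero>"
  have "qre (q \<otimes>\<^bsub>quat_ring R\<^esub> q) = \<ominus> (c \<otimes> c \<otimes> (\<one> \<oplus> a \<otimes> a \<oplus> b \<otimes> b))"
    using a b c(1)
    by (simp add: q_def quat_ring_def quat_mult_def a_minus_def r_distr minus_add a_ac m_ac)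
  then have sq: "q \<otimes>\<^bsub>quat_ring R\<^esub> q = \<zero>\<^bsub>quat_ring R\<^esub>"
    using a b c(1) norm
    by (auto simp: q_def quat_ring_def quat_mult_def a_minus_def m_ac l_neg r_neg intro!: quat.expand)
  have nc: "\<ominus> c \<noteq> \<zero>"
    using c by (metis minus_minus minus_zero)
  have carr: "q \<in> carrier (quat_ring R)" "r \<in> carrier (quat_ring R)" "s \<in> carrier (quat_ring R)"
    using a b c by (auto simp: q_def r_def s_def quat_ring_def)
  have coords: "qre q = \<zero>" "qi q = c"
    "qre (q \<otimes>\<^bsub>quat_ring R\<^esub> r) = \<ominus> c" "qi (q \<otimes>\<^bsub>quat_ring R\<^esub> r) = \<zero>"
    "qre (s \<otimes>\<^bsub>quat_ring R\<^esub> q) = \<ominus> c" "qi (s \<otimes>\<^bsub>quat_ring R\<^esub> q) = c"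
    using a b c(1)
    by (auto simp: q_def r_def s_def quat_ring_def quat_mult_def a_minus_def)
  have zero: "qre \<zero>\<^bsub>quat_ring R\<^esub> = \<zero>" "qi \<zero>\<^bsub>quat_ring R\<^esub> = \<zero>"
    by (simp_all add: quat_ring_def)
  show ?thesis
  proof (rule H.girth_eq_3_if_square_zero[OF carr sq])
    show "q \<noteq> \<zero>\<^bsub>quat_ring R\<^esub>"
      using coords zero c(2) by metis
    show "q \<otimes>\<^bsub>quat_ring R\<^esub> r \<noteq> \<zero>\<^bsub>quat_ring R\<^esub>" "s \<otimes>\<^bsub>quat_ring R\<^esub> q \<noteq> \<zero>\<^bsub>quat_ring R\<^esub>"
      using coords zero nc by metis+
    have "q \<noteq> q \<otimes>\<^bsub>quat_ring R\<^esub> r" "q \<noteq> s \<otimes>\<^bsub>quat_ring R\<^esub> q"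
      using coords nc by metis+
    moreover have "q \<otimes>\<^bsub>quat_ring R\<^esub> r \<noteq> s \<otimes>\<^bsub>quat_ring R\<^esub> q"
      using coords c(2) by metis
    ultimately show "distinct [q, q \<otimes>\<^bsub>quat_ring R\<^esub> r, s \<otimes>\<^bsub>quat_ring R\<^esub> q]"
      by simp
  qed
qed

lemma inj_on_square_mod_prime:
  fixes p :: int
  assumes "prime p"
  shows "inj_on (\<lambda>x. x\<^sup>2 mod p) {0..p div 2}"
proof (rule inj_onI)
  fix x y assume x: "x \<in> {0..p div 2}" and y: "y \<in> {0..p div 2}" and "x\<^sup>2 mod p = y\<^sup>2 mod p"
  then have "p dvd (x - y) * (x + y)"
    by (simp add: mod_eq_dvd_iff power2_eq_square algebra_simps)
  then consider "p dvd x - y" | "p dvd x + y"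
    using assms prime_dvd_mult_iff by blast
  then show "x = y"
  proof cases
    case 1
    have "\<bar>x - y\<bar> < p"
      using x y prime_gt_1_int[OF assms] by auto
    then show ?thesis
      using 1 zdvd_imp_le[of p "\<bar>x - y\<bar>"] by force
  next
    \<comment> \<open>Here \<open>x + y \<le> p\<close>, so \<open>x + y\<close> is \<open>0\<close> or \<open>p\<close>, and \<open>p\<close> forces \<open>x = y = p / 2\<close>.\<close>
    case 2
    then show ?thesis
      using x y zdvd_imp_le[of p "x + y"] by force
  qed
qed

text \<open>
  The squares of \<open>0, \<dots>, p div 2\<close>, and likewise their shifted negatives \<open>-1 - b\<^sup>2\<close>, take
  \<open>p div 2 + 1\<close> values modulo \<open>p\<close>. Together these are more than \<open>p\<close>, so some
  \<open>a\<^sup>2\<close> meets some \<open>-1 - b\<^sup>2\<close>.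
\<close>

lemma prime_dvd_one_plus_two_squares:
  fixes p :: int
  assumes "prime p"
  obtains a b where "p dvd 1 + a\<^sup>2 + b\<^sup>2"
proof -
  have p: "p > 1"
    using prime_gt_1_int[OF assms] .
  let ?I = "{0..p div 2}"
  let ?f = "\<lambda>x. x\<^sup>2 mod p" and ?g = "\<lambda>x. (-1 - x\<^sup>2) mod p"
  have inj_f: "inj_on ?f ?I"
    by (rule inj_on_square_mod_prime[OF assms])
  have inj_g: "inj_on ?g ?I"
  proof (rule inj_onI)
    fix x y assume xy: "x \<in> ?I" "y \<in> ?I" and "?g x = ?g y"
    then have "p dvd y\<^sup>2 - x\<^sup>2"
      by (simp add: mod_eq_dvd_iff)
    then have "?f y = ?f x"
      by (simp add: mod_eq_dvd_iff)
    then show "x = y"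
      using inj_f xy by (auto dest: inj_onD)
  qed
  have "?f ` ?I \<inter> ?g ` ?I \<noteq> {}"
  proof
    assume "?f ` ?I \<inter> ?g ` ?I = {}"
    then have "card (?f ` ?I) + card (?g ` ?I) = card (?f ` ?I \<union> ?g ` ?I)"
      by (simp add: card_Un_disjoint)
    also have "\<dots> \<le> card {0..<p}"
      using p by (intro card_mono) auto
    finally have "2 * nat (p div 2 + 1) \<le> nat p"
      by (simp add: card_image[OF inj_f] card_image[OF inj_g])
    then show False
      using p by linarith
  qed
  then obtain a b where "?f a = ?g b"
    by blast
  then have "p dvd 1 + a\<^sup>2 + b\<^sup>2"
    by (simp add: mod_eq_dvd_iff algebra_simps)
  then show thesis
    by (rule that)
qed

theorem theorem8:
  fixes n :: int
  assumes "n > 1"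
  shows "girth (zero_divisor_graph (quat_ring (residue_ring n))) = 3"
proof -
  interpret residues n "residue_ring n"
    by unfold_locales (use assms in auto)
  obtain p where p: "prime p" "p dvd n"
    using assms prime_factor_int[of n] by force
  obtain a b where ab: "p dvd 1 + a\<^sup>2 + b\<^sup>2"
    using prime_dvd_one_plus_two_squares[OF p(1)] .
  obtain c where c: "n = p * c"
    using p(2) by blast
  have p_gt_1: "p > 1"
    using prime_gt_1_int[OF p(1)] .
  have c_pos: "0 < c"
    using c assms p_gt_1 zero_less_mult_pos[of p c] by linarith
  have c_less: "c < n"
    using c mult_strict_right_mono[OF p_gt_1 c_pos] by simp
  have "n dvd c * c * (1 + a\<^sup>2 + b\<^sup>2)"
    unfolding c using ab by (simp add: mult_dvd_mono mult.commute mult.left_commute)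
  then have "(c * c * (1 + a\<^sup>2 + b\<^sup>2)) mod n = 0"
    by simp
  then show ?thesis
    using assms c_pos c_less
    by (intro girth_quat_ring_eq_3[of "a mod n" "b mod n" c])
      (simp_all add: res_carrier_eq res_zero_eq res_one_eq res_add_eq res_mult_eq
        power2_eq_square mod_simps)
qed

end
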